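(* Let $p \ge 2$ be an integer, and let $$c = \frac{ \log \left(\frac{p}{p-1}\right) \log 2 }{ \log \left(\frac{2p}{p-1}\right) \log p }.$$ There exist constants $N>0$ and $b>0$, depending only on $p$, such that for every integer $n \ge N$ there exists a $(\lfloor \log_p n \rfloor +1,\,p,\,p-1)$-composite rational function $r$ of type $(n,n-1)$ such that $$\max_{x \in [0,1]} |r(x)-x^{1/p}| \le \exp( -b n^c ).$$
   Context: A univariate rational function $r(x)=P(x)/Q(x)$ is of type $(m,\ell)$ if $P$ and $Q$ are polynomials of degrees at most $m$ and $\ell$, respectively. A bivariate rational function $r(x,y)$ is of type $(m,\ell)$ if the univariate rational function $r(x,x)$ is of type $(m,\ell)$. A univariate rational function $r$ is $(k,m,\ell)$-composite if it is a composition of $k$ bivariate rational functions $r_i(x,y)$, $i=1,\dots,k$, each of type $(m,\ell)$, of the form $$r(x) = r_k(x, r_{k-1}(x, r_{k-2}( \cdots (x,r_1(x,1))))).$$ *)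

theory Defs
  imports Complex_Main "HOL-Computational_Algebra.Computational_Algebra"
begin

text \<open>
  Univariate rational functions are elements of the fraction field R(x), \<open>real poly fract\<close>.
  Bivariate rational functions are elements of R(x,y), the fraction field of R[x][y],
  \<open>real poly poly fract\<close>: the outer polynomial variable is y, the inner one is x.
\<close>

definition rat_type :: "nat \<Rightarrow> nat \<Rightarrow> real poly fract \<Rightarrow> bool" where
  "rat_type m l r \<longleftrightarrow>
     (\<exists>P Q. Q \<noteq> 0 \<and> degree P \<le> m \<and> degree Q \<le> l \<and> r = Fract P Q)"

text \<open>
  \<open>rat_value r a v\<close>: the rational function r has no pole at a, and r(a) = v.  Ranging over all
  representatives P/Q makes removable singularities harmless and excludes division by zero.
\<close>

definition rat_value :: "real poly fract \<Rightarrow> real \<Rightarrow> real \<Rightarrow> bool" where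
  "rat_value r a v \<longleftrightarrow>
     (\<exists>P Q. r = Fract P Q \<and> poly Q a \<noteq> 0 \<and> v = poly P a / poly Q a)"

lemma rat_value_unique: "rat_value r a v \<Longrightarrow> rat_value r a w \<Longrightarrow> v = w"
proof -
  assume "rat_value r a v" "rat_value r a w"
  then obtain P Q P' Q' where *: "r = Fract P Q" "poly Q a \<noteq> 0" "v = poly P a / poly Q a"
      "r = Fract P' Q'" "poly Q' a \<noteq> 0" "w = poly P' a / poly Q' a"
    unfolding rat_value_def by blast
  from * have "Q \<noteq> 0" "Q' \<noteq> 0" by auto
  with * have "P * Q' = P' * Q" by (metis eq_fract(1))
  then have "poly P a * poly Q' a = poly P' a * poly Q a" by (metis poly_mult)
  with * show "v = w" by (simp add: frac_eq_eq)
qed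

text \<open>\<open>subst_y R s t\<close>: R(x, s(x)) is defined as an element of R(x), and equals t.\<close>

definition subst_y :: "real poly poly fract \<Rightarrow> real poly fract \<Rightarrow> real poly fract \<Rightarrow> bool" where
  "subst_y R s t \<longleftrightarrow>
     (\<exists>P Q. R = Fract P Q \<and> poly (fract_poly Q) s \<noteq> 0 \<and>
            t = poly (fract_poly P) s / poly (fract_poly Q) s)"

lemma subst_y_unique: "subst_y R s t \<Longrightarrow> subst_y R s u \<Longrightarrow> t = u"
proof -
  assume "subst_y R s t" "subst_y R s u"
  then obtain P Q P' Q' where *: "R = Fract P Q" "poly (fract_poly Q) s \<noteq> 0"
      "t = poly (fract_poly P) s / poly (fract_poly Q) s"
      "R = Fract P' Q'" "poly (fract_poly Q') s \<noteq> 0"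
      "u = poly (fract_poly P') s / poly (fract_poly Q') s"
    unfolding subst_y_def by blast
  from * have "Q \<noteq> 0" "Q' \<noteq> 0" by auto
  with * have "P * Q' = P' * Q" by (metis eq_fract(1))
  then have "fract_poly P * fract_poly Q' = fract_poly P' * fract_poly Q"
    by (metis fract_poly_mult)
  then have "poly (fract_poly P) s * poly (fract_poly Q') s =
             poly (fract_poly P') s * poly (fract_poly Q) s"
    by (metis poly_mult)
  with * show "t = u" by (simp add: frac_eq_eq)
qed

text \<open>
  The type of R(x,y) is that of the diagonal R(x,x), which must be defined; \<open>[:0, 1:]\<close> is x.
\<close>

definition biv_type :: "nat \<Rightarrow> nat \<Rightarrow> real poly poly fract \<Rightarrow> bool" where
  "biv_type m l R \<longleftrightarrow> (\<exists>t. subst_y R (to_fract [:0, 1:]) t \<and> rat_type m l t)"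

text \<open>
  \<open>composite k m l r\<close>: r is (k,m,l)-composite.  The innermost function is evaluated at y = 1,
  and every substitution in the composition has to be defined.
\<close>

inductive composite :: "nat \<Rightarrow> nat \<Rightarrow> nat \<Rightarrow> real poly fract \<Rightarrow> bool" where
  first: "biv_type m l R \<Longrightarrow> subst_y R 1 r \<Longrightarrow> composite 1 m l r"
| step: "composite k m l s \<Longrightarrow> biv_type m l R \<Longrightarrow> subst_y R s r \<Longrightarrow> composite (Suc k) m l r"

end

theory Submission
  imports Defs
begin

text \<open>
  The approximants come from a scaled Newton iteration for the \<open>p\<close>-th root.  With
  \<open>H(x,y) = ((p-1) y + x / y^(p-1)) / p\<close>, put \<open>f_0 = 1\<close> and \<open>f_(j+1)(x) = H(x, \<mu>_j f_j(x))\<close> for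
  suitable scaling factors \<open>\<mu>_j > 0\<close>.  On the diagonal, \<open>H(x, \<mu> x)\<close> has type \<open>(p, p-1)\<close>, and each
  step multiplies degrees by \<open>p\<close>, so that \<open>f_j\<close> is a composition of \<open>j+1\<close> functions and has type
  \<open>(p^j, p^j - 1)\<close>.

  The error is controlled through the substitution \<open>x = s^p\<close>.  The invariant is
  \<open>s \<le> f_j(s^p) \<le> \<rho>_j max(s, a)\<close> on \<open>[0,1]\<close>, where \<open>a = exp(-L)\<close> is a cutoff; its
  lower half holds for every \<open>\<mu>_j\<close> by the inequality of arithmetic and geometric means.  Initially
  \<open>\<rho>_0 = exp L\<close>.  There are two regimes.

  \<^item> While \<open>\<rho>\<close> is large, the scaling \<open>\<mu> = \<rho> powr (-1/p)\<close> turns \<open>\<rho>\<close> into \<open>\<rho> powr (1 - 1/p)\<close>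
    (\<open>newton_map_scaled_le\<close>).  Thus \<open>ln \<rho>\<close> shrinks by the factor \<open>q = p/(p-1)\<close> in each step, and
    \<open>i\<close> steps bring it from \<open>L = \<kappa> q^i\<close> down to a constant \<open>\<kappa>\<close>.

  \<^item> Once \<open>\<rho> = 1 + w/(p-1)\<close> with \<open>w \<le> 1/2\<close>, the unscaled iteration converges quadratically: it replaces
    \<open>w\<close> by \<open>w\<^sup>2\<close> (\<open>newton_map_quadratic\<close>), so \<open>j\<close> further steps give \<open>w \<le> 2^(-2^j)\<close>.

  The total error is at most \<open>w + a\<close>, with exponents of orders \<open>2^j\<close> and \<open>q^i\<close>.  Splitting
  \<open>i + j = K = \<lfloor>log p n\<rfloor>\<close> so as to balance them, that is \<open>i \<approx> K ln 2 / ln (2 q)\<close>, makes both of order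
  \<open>B^K\<close> with \<open>B = exp (ln q ln 2 / ln (2 q)) = p powr c\<close> (\<open>balanced_split\<close>), hence of order
  \<open>n powr c\<close>.
\<close>

section \<open>The Newton map for the p-th root\<close>

text \<open>
  One Newton step for the equation \<open>y^p = x\<close>, starting from \<open>y\<close>.
\<close>

definition newton_map :: "nat \<Rightarrow> real \<Rightarrow> real \<Rightarrow> real" where
  "newton_map p x y = ((real p - 1) * y + x / y ^ (p - 1)) / real p"

lemma power_eq_mult_pred: "p > 0 \<Longrightarrow> (y::'a::monoid_mult) ^ p = y * y ^ (p - 1)"
  by (cases p) auto

text \<open>
  The arithmetic mean of \<open>p-1\<close> copies of \<open>y\<close> and of \<open>s^p / y^(p-1)\<close> is at least their geometric
  mean \<open>s\<close>.
\<close>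

lemma newton_map_ge:
  assumes "p \<ge> 2" "0 \<le> s" "0 < y"
  shows "s \<le> newton_map p (s ^ p) y"
proof -
  have "1 + real p * (s / y - 1) \<le> (1 + (s / y - 1)) ^ p"
    by (rule Bernoulli_inequality) (use assms in auto)
  then have "1 + real p * (s / y - 1) \<le> s ^ p / y ^ p"
    by (simp add: power_divide)
  then have "y * (1 + real p * (s / y - 1)) \<le> y * (s ^ p / y ^ p)"
    using assms by (intro mult_left_mono) auto
  moreover have "y * (s ^ p / y ^ p) = s ^ p / y ^ (p - 1)"
    using assms power_eq_mult_pred[of p y] by simp
  moreover have "y * (1 + real p * (s / y - 1)) = y + real p * s - real p * y"
    using assms by (simp add: algebra_simps)
  ultimately have "y + real p * s - real p * y \<le> s ^ p / y ^ (p - 1)" by simp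
  then have "s * real p \<le> (real p - 1) * y + s ^ p / y ^ (p - 1)"
    by (simp add: algebra_simps)
  then show ?thesis using assms by (simp add: newton_map_def pos_le_divide_eq)
qed

lemma newton_map_mono:
  assumes "p \<ge> 2" "0 \<le> s" "s \<le> y" "0 < y" "y \<le> z"
  shows "newton_map p (s ^ p) y \<le> newton_map p (s ^ p) z"
proof -
  have z: "z > 0" using assms by auto
  have "1 + real (p - 1) * (y / z - 1) \<le> (1 + (y / z - 1)) ^ (p - 1)"
    by (rule Bernoulli_inequality) (use assms z in auto)
  then have *: "1 - (real p - 1) * (1 - y / z) \<le> y ^ (p - 1) / z ^ (p - 1)"
    using assms by (simp add: power_divide of_nat_diff algebra_simps)
  have "s ^ p / y ^ (p - 1) - s ^ p / z ^ (p - 1) = s ^ p * (1 / y ^ (p - 1) - 1 / z ^ (p - 1))"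
    by (simp add: algebra_simps)
  also have "\<dots> \<le> y ^ p * (1 / y ^ (p - 1) - 1 / z ^ (p - 1))"
    using assms z by (intro mult_right_mono power_mono) (auto intro!: divide_left_mono power_mono)
  also have "\<dots> = y * (1 - y ^ (p - 1) / z ^ (p - 1))"
    using assms power_eq_mult_pred[of p y] by (simp add: field_simps)
  also have "\<dots> \<le> y * ((real p - 1) * (1 - y / z))"
    using * assms by (intro mult_left_mono) auto
  also have "\<dots> = (real p - 1) * ((z - y) * (y / z))"
    using z by (simp add: field_simps)
  also have "\<dots> \<le> (real p - 1) * ((z - y) * 1)"
    using assms z by (intro mult_left_mono) auto
  finally show ?thesis using assms unfolding newton_map_def
    by (intro divide_right_mono) (auto simp: algebra_simps)
qed

lemma newton_map_le_self:
  assumes "p \<ge> 2" "0 \<le> s" "s \<le> y" "0 < y"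
  shows "newton_map p (s ^ p) y \<le> y"
proof -
  have "s ^ p \<le> y ^ p" using assms by (intro power_mono) auto
  then have "s ^ p / y ^ (p - 1) \<le> y"
    using assms power_eq_mult_pred[of p y] by (simp add: field_simps)
  then show ?thesis using assms unfolding newton_map_def
    by (simp add: field_simps)
qed

text \<open>
  Contraction of a large ratio.  If \<open>s \<le> y \<le> exp L * m\<close>, then \<open>y\<close> scaled by \<open>exp (-L/p)\<close> lies
  between \<open>exp (-L/p) * s\<close> and \<open>E * m\<close> with \<open>E = exp (L (p-1)/p)\<close>; from either extreme, a Newton
  step ends at or below \<open>E * m\<close>.  The upper bounds refer to some \<open>m \<ge> s\<close> in place of \<open>s\<close>, since
  no relative accuracy is available near 0.
\<close>

lemma newton_map_scaled_le:
  assumes "p \<ge> 2" "0 \<le> L" "0 \<le> s" "s \<le> m" "0 < y" "s \<le> y" "y \<le> exp L * m"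
  shows "newton_map p (s ^ p) (exp (- L / real p) * y)
    \<le> exp ((real p - 1) / real p * L) * m"
proof (cases "s \<le> exp (- L / real p) * y")
  case True
  \<comment> \<open>Above the root, a Newton step decreases its argument.\<close>
  have "newton_map p (s ^ p) (exp (- L / real p) * y) \<le> exp (- L / real p) * y"
    using assms True by (intro newton_map_le_self) auto
  also have "\<dots> \<le> exp (- L / real p) * (exp L * m)"
    using assms by (intro mult_left_mono) auto
  also have "\<dots> = exp ((real p - 1) / real p * L) * m"
    using assms by (simp add: field_simps flip: exp_add mult.assoc)
  finally show ?thesis .
next
  case False
  define E where "E = exp ((real p - 1) / real p * L)"
  have E: "E \<ge> 1" unfolding E_def using assms by auto
  have s: "s > 0" using False assms
    by (smt (verit) exp_gt_zero mult_pos_pos)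
  have "exp (- L / real p) ^ (p - 1) = exp (real (p - 1) * (- L / real p))"
    by (rule exp_of_nat_mult[symmetric])
  also have "\<dots> = 1 / E" unfolding E_def using assms
    by (simp add: of_nat_diff exp_minus field_simps flip: exp_add)
  finally have pw: "exp (- L / real p) ^ (p - 1) = 1 / E" .
  \<comment> \<open>Below the root, the linear term is at most \<open>(p-1) s\<close>; the other one is bounded using \<open>y \<ge> s\<close>.\<close>
  have "s ^ p / (exp (- L / real p) * y) ^ (p - 1)
      \<le> s ^ p / (exp (- L / real p) * s) ^ (p - 1)"
    using assms s by (intro divide_left_mono power_mono mult_left_mono) auto
  also have "\<dots> = E * s"
    using s assms E power_eq_mult_pred[of p s] unfolding power_mult_distrib pw by simp
  finally have "newton_map p (s ^ p) (exp (- L / real p) * y) \<le> ((real p - 1) * s + E * s) / real p"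
    using assms False unfolding newton_map_def
    by (intro divide_right_mono add_mono mult_left_mono) auto
  also have "\<dots> \<le> ((real p - 1) * (E * s) + E * s) / real p"
    using assms E s by (intro divide_right_mono add_mono mult_left_mono) auto
  also have "\<dots> = E * s" using assms by (simp add: field_simps)
  also have "\<dots> \<le> E * m" using assms E by auto
  finally show ?thesis unfolding E_def .
qed

text \<open>
  Quadratic convergence, in the variable \<open>w = (p-1) (y/m - 1)\<close>, for which Bernoulli's inequality
  \<open>(1 + w/(p-1))^(p-1) \<ge> 1 + w\<close> makes the constant in front of \<open>w\<^sup>2\<close> at most 1.
\<close>

lemma newton_map_quadratic:
  assumes "p \<ge> 2" "0 \<le> w" "0 \<le> s" "s \<le> m" "0 < y" "s \<le> y"
    and "y \<le> (1 + w / (real p - 1)) * m"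
  shows "newton_map p (s ^ p) y \<le> (1 + w\<^sup>2 / (real p - 1)) * m"
proof -
  define z where "z = 1 + w / (real p - 1)"
  have z: "z \<ge> 1" using assms by (auto simp: z_def)
  have m: "m > 0" using assms z unfolding z_def[symmetric]
    by (smt (verit) mult_nonneg_nonpos)
  have "1 + real (p - 1) * (w / (real p - 1)) \<le> (1 + w / (real p - 1)) ^ (p - 1)"
    by (rule Bernoulli_inequality) (use assms in \<open>auto intro: order_trans[of _ 0]\<close>)
  then have "1 + w \<le> z ^ (p - 1)" using assms by (simp add: z_def of_nat_diff)
  then have zp: "1 / z ^ (p - 1) \<le> 1 / (1 + w)"
    using assms z by (intro divide_left_mono) auto
  \<comment> \<open>By monotonicity in both arguments, only the extreme case \<open>s = m\<close>, \<open>y = z m\<close> matters.\<close>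
  have "newton_map p (s ^ p) y \<le> newton_map p (s ^ p) (z * m)"
    using assms unfolding z_def by (intro newton_map_mono) auto
  also have "\<dots> \<le> newton_map p (m ^ p) (z * m)"
    unfolding newton_map_def using assms m z
    by (intro divide_right_mono add_mono power_mono) auto
  also have "\<dots> = m * (((real p - 1) * z + 1 / z ^ (p - 1)) / real p)"
    unfolding newton_map_def using m z assms power_eq_mult_pred[of p m]
    by (simp add: power_mult_distrib field_simps)
  also have "\<dots> \<le> m * (((real p - 1) * z + 1 / (1 + w)) / real p)"
    using zp m assms by (intro mult_left_mono divide_right_mono add_mono) auto
  also have "(real p - 1) * z = real p - 1 + w"
    using assms by (simp add: z_def field_simps)
  also have "real p - 1 + w + 1 / (1 + w) = real p + w\<^sup>2 / (1 + w)"
    using assms by (simp add: field_simps power2_eq_square)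
  also have "(real p + w\<^sup>2 / (1 + w)) / real p = 1 + w\<^sup>2 / ((1 + w) * real p)"
    using assms by (simp add: add_divide_distrib)
  also have "m * (1 + w\<^sup>2 / ((1 + w) * real p)) \<le> m * (1 + w\<^sup>2 / (1 * (real p - 1)))"
    using assms m by (intro mult_left_mono add_mono divide_left_mono mult_mono) auto
  finally show ?thesis by (simp add: mult.commute)
qed

section \<open>The Newton map as a bivariate rational function\<close>

text \<open>
  The function \<open>H(x, \<mu> y)\<close>, written over the common denominator \<open>p (\<mu> y)^(p-1)\<close>, as an element of
  R(x,y); the outer polynomial variable is \<open>y\<close>.
\<close>

definition newton_biv :: "nat \<Rightarrow> real \<Rightarrow> real poly poly fract" where
  "newton_biv p \<mu> = Fract (monom [:(real p - 1) * \<mu> ^ p:] p + [:[:0, 1:]:])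
     (monom [:real p * \<mu> ^ (p - 1):] (p - 1))"

lemma to_fract_power: "to_fract (a ^ n) = to_fract a ^ n"
  by (induction n) auto

text \<open>
  Substituting \<open>y = A/B\<close> and clearing denominators.
\<close>

lemma subst_y_newton_biv:
  assumes "p \<ge> 2" "\<mu> > 0" "A \<noteq> 0" "B \<noteq> 0"
  shows "subst_y (newton_biv p \<mu>) (Fract A B)
    (Fract (smult ((real p - 1) * \<mu> ^ p) (A ^ p) + [:0, 1:] * B ^ p)
       (smult (real p * \<mu> ^ (p - 1)) (A ^ (p - 1) * B)))"
proof -
  let ?c = "(real p - 1) * \<mu> ^ p" and ?d = "real p * \<mu> ^ (p - 1)"
  let ?P = "monom [:?c:] p + [:[:0, 1:]:]" and ?Q = "monom [:?d:] (p - 1)"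
  have d: "?d \<noteq> 0" using assms by auto
  have AB: "Fract A B = to_fract A / to_fract B" by (rule Fract_conv_to_fract)
  have nz: "to_fract A \<noteq> 0" "to_fract B \<noteq> 0" "to_fract [:?d:] \<noteq> 0" using assms d by auto
  have P: "poly (fract_poly ?P) (Fract A B)
      = to_fract [:?c:] * (Fract A B) ^ p + to_fract [:0, 1:]"
    by (simp add: map_poly_pCons map_poly_monom poly_monom)
  have Q: "poly (fract_poly ?Q) (Fract A B) = to_fract [:?d:] * (Fract A B) ^ (p - 1)"
    by (simp add: map_poly_monom poly_monom)
  have Bp: "to_fract B ^ p = to_fract B * to_fract B ^ (p - 1)"
    using assms by (intro power_eq_mult_pred) auto
  have sm: "smult a X = [:a:] * X" for a :: real and X by simp
  have "Fract (smult ?c (A ^ p) + [:0, 1:] * B ^ p) (smult ?d (A ^ (p - 1) * B))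
    = (to_fract [:?c:] * to_fract A ^ p + to_fract [:0, 1:] * to_fract B ^ p)
      / (to_fract [:?d:] * (to_fract A ^ (p - 1) * to_fract B))"
    unfolding Fract_conv_to_fract sm to_fract_add to_fract_mult to_fract_power ..
  also have "\<dots> = poly (fract_poly ?P) (Fract A B) / poly (fract_poly ?Q) (Fract A B)"
    unfolding P Q
    unfolding AB power_divide Bp using nz by (simp add: field_simps)
  finally show ?thesis unfolding subst_y_def newton_biv_def
    using nz Q AB by (intro exI[of _ ?P] exI[of _ ?Q]) auto
qed

lemma degree_newton_numerator:
  assumes "p \<ge> 2" "m > 0" "degree A \<le> m" "degree B \<le> m - 1"
  shows "degree (smult c (A ^ p) + [:0, 1:] * B ^ p) \<le> p * m"
proof (rule degree_add_le)
  have "degree (A ^ p) \<le> degree A * p" by (rule degree_power_le)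
  also have "\<dots> \<le> p * m" using assms by (simp add: mult.commute)
  finally show "degree (smult c (A ^ p)) \<le> p * m"
    using degree_smult_le order_trans by blast
  have "degree ([:0, 1:] * B ^ p) \<le> degree [:0, 1::'a:] + degree (B ^ p)"
    by (rule degree_mult_le)
  also have "\<dots> \<le> 1 + degree B * p" using degree_power_le[of B p] by simp
  also have "\<dots> \<le> 1 + (m - 1) * p" using assms by simp
  also have "\<dots> \<le> p * m" using assms by (cases m) auto
  finally show "degree ([:0, 1:] * B ^ p) \<le> p * m" .
qed

lemma degree_newton_denominator:
  assumes "p \<ge> 2" "m > 0" "degree A \<le> m" "degree B \<le> m - 1"
  shows "degree (smult d (A ^ (p - 1) * B)) \<le> p * m - 1"
proof -
  have "degree (smult d (A ^ (p - 1) * B)) \<le> degree (A ^ (p - 1) * B)"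
    by (rule degree_smult_le)
  also have "\<dots> \<le> degree (A ^ (p - 1)) + degree B" by (rule degree_mult_le)
  also have "\<dots> \<le> m * (p - 1) + (m - 1)"
    using degree_power_le[of A "p - 1"] mult_le_mono1[OF assms(3), of "p - 1"] assms by linarith
  also have "\<dots> = p * m - 1" using assms by (cases p) (auto simp: algebra_simps)
  finally show ?thesis .
qed

lemma biv_type_newton_biv:
  assumes "p \<ge> 2" "\<mu> > 0"
  shows "biv_type p (p - 1) (newton_biv p \<mu>)"
proof -
  let ?P = "smult ((real p - 1) * \<mu> ^ p) ([:0, 1:] ^ p) + [:0, 1:] * 1 ^ p"
  let ?Q = "smult (real p * \<mu> ^ (p - 1)) ([:0, 1:] ^ (p - 1) * 1)"
  have "subst_y (newton_biv p \<mu>) (to_fract [:0, 1:]) (Fract ?P ?Q)"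
    unfolding to_fract_def using assms by (intro subst_y_newton_biv) auto
  moreover have "degree ?P \<le> p * 1"
    using assms by (intro degree_newton_numerator) auto
  moreover have "degree ?Q \<le> p * 1 - 1"
    using assms by (intro degree_newton_denominator) auto
  moreover have "?Q \<noteq> 0" using assms by auto
  ultimately show ?thesis unfolding biv_type_def rat_type_def mult_1_right by blast
qed

section \<open>Iterates and their accuracy\<close>

text \<open>
  \<open>root_approx p j a \<rho>\<close>: some composition \<open>A/B\<close> of \<open>j+1\<close> functions of type \<open>(p, p-1)\<close>, with the degrees
  that \<open>j\<close> Newton steps produce, approximates the \<open>p\<close>-th root on \<open>[0,1]\<close> from above, within the
  factor \<open>\<rho>\<close> relative to the root truncated below at \<open>a\<close>.  Points of \<open>[0,1]\<close> are written
  \<open>s^p\<close>, so the root is \<open>s\<close>.  Strict positivity of \<open>A\<close> and \<open>B\<close> excludes poles and keeps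
  the next Newton step defined.
\<close>

definition root_approx :: "nat \<Rightarrow> nat \<Rightarrow> real \<Rightarrow> real \<Rightarrow> bool" where
  "root_approx p j a \<rho> \<longleftrightarrow> (\<exists>A B. composite (Suc j) p (p - 1) (Fract A B) \<and>
     degree A \<le> p ^ j \<and> degree B \<le> p ^ j - 1 \<and>
     (\<forall>s\<in>{0..1}. poly A (s ^ p) > 0 \<and> poly B (s ^ p) > 0 \<and>
        s \<le> poly A (s ^ p) / poly B (s ^ p) \<and>
        poly A (s ^ p) / poly B (s ^ p) \<le> \<rho> * max s a))"

text \<open>
  The constant 1 is the innermost function; it exceeds \<open>max(s, exp (-L))\<close> by at most the factor
  \<open>exp L\<close>.
\<close>

lemma root_approx_start:
  assumes "p \<ge> 2"
  shows "root_approx p 0 (exp (- L)) (exp L)"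
proof -
  have sub: "subst_y 1 t 1" for t
    unfolding subst_y_def by (intro exI[of _ 1]) (simp flip: One_fract_def)
  have "rat_type p (p - 1) 1"
    unfolding rat_type_def by (intro exI[of _ 1]) (simp add: One_fract_def)
  then have "composite 1 p (p - 1) 1"
    using sub by (intro composite.first[where R = 1]) (auto simp: biv_type_def)
  moreover have "1 \<le> exp L * max s (exp (- L))" for s
  proof -
    have "1 = exp L * exp (- L)" by (simp flip: exp_add)
    also have "\<dots> \<le> exp L * max s (exp (- L))" by (intro mult_left_mono) auto
    finally show ?thesis .
  qed
  ultimately show ?thesis unfolding root_approx_def
    by (intro exI[of _ 1]) (auto simp: One_fract_def)
qed

text \<open>
  One Newton step with scaling \<open>\<mu>\<close> preserves everything but the factor \<open>\<rho>\<close>; the change of \<open>\<rho>\<close> is a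
  question about \<open>newton_map\<close> alone.
\<close>

lemma root_approx_step:
  assumes "p \<ge> 2" "\<mu> > 0" "root_approx p j a \<rho>"
    and upper: "\<And>s y. 0 \<le> s \<Longrightarrow> 0 < y \<Longrightarrow> s \<le> y \<Longrightarrow> y \<le> \<rho> * max s a \<Longrightarrow>
      newton_map p (s ^ p) (\<mu> * y) \<le> \<rho>' * max s a"
  shows "root_approx p (Suc j) a \<rho>'"
proof -
  obtain A B where comp: "composite (Suc j) p (p - 1) (Fract A B)"
    and deg: "degree A \<le> p ^ j" "degree B \<le> p ^ j - 1"
    and val: "\<And>s. s \<in> {0..1} \<Longrightarrow> poly A (s ^ p) > 0 \<and> poly B (s ^ p) > 0 \<and>
        s \<le> poly A (s ^ p) / poly B (s ^ p) \<and>
        poly A (s ^ p) / poly B (s ^ p) \<le> \<rho> * max s a"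
    using assms(3) unfolding root_approx_def by blast
  define A' where "A' = smult ((real p - 1) * \<mu> ^ p) (A ^ p) + [:0, 1:] * B ^ p"
  define B' where "B' = smult (real p * \<mu> ^ (p - 1)) (A ^ (p - 1) * B)"
  have "A \<noteq> 0" "B \<noteq> 0" using val[of 0] by auto
  then have "composite (Suc (Suc j)) p (p - 1) (Fract A' B')"
    unfolding A'_def B'_def using assms(1,2)
    by (intro composite.step[OF comp biv_type_newton_biv subst_y_newton_biv])
  moreover have "degree A' \<le> p ^ Suc j" "degree B' \<le> p ^ Suc j - 1"
    unfolding A'_def B'_def power_Suc using assms deg
    by (intro degree_newton_numerator degree_newton_denominator; simp)+
  moreover have "poly A' (s ^ p) > 0 \<and> poly B' (s ^ p) > 0 \<and>
        s \<le> poly A' (s ^ p) / poly B' (s ^ p) \<and>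
        poly A' (s ^ p) / poly B' (s ^ p) \<le> \<rho>' * max s a" if s: "s \<in> {0..1}" for s
  proof -
    define u where "u = poly A (s ^ p)"
    define v where "v = poly B (s ^ p)"
    have uv: "u > 0" "v > 0" "s \<le> u / v" "u / v \<le> \<rho> * max s a"
      using val[OF s] by (auto simp: u_def v_def)
    have eq: "poly A' (s ^ p) = (real p - 1) * \<mu> ^ p * u ^ p + s ^ p * v ^ p"
      "poly B' (s ^ p) = real p * \<mu> ^ (p - 1) * (u ^ (p - 1) * v)"
      by (auto simp: A'_def B'_def u_def v_def)
    have pos: "poly A' (s ^ p) > 0" "poly B' (s ^ p) > 0"
      unfolding eq using assms uv s by (auto intro!: add_pos_nonneg)
    have "poly A' (s ^ p) / poly B' (s ^ p) = newton_map p (s ^ p) (\<mu> * (u / v))"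
      unfolding eq newton_map_def using assms uv
        power_eq_mult_pred[of p u] power_eq_mult_pred[of p v] power_eq_mult_pred[of p \<mu>]
      by (simp add: power_mult_distrib power_divide divide_simps)
    moreover have "s \<le> newton_map p (s ^ p) (\<mu> * (u / v))"
      using assms uv s by (intro newton_map_ge) auto
    moreover have "newton_map p (s ^ p) (\<mu> * (u / v)) \<le> \<rho>' * max s a"
      using uv s by (intro upper) auto
    ultimately show ?thesis using pos by simp
  qed
  ultimately show ?thesis unfolding root_approx_def by blast
qed

lemma root_approx_scaled_iterates:
  assumes "p \<ge> 2" "0 \<le> L"
  shows "root_approx p j (exp (- L)) (exp (((real p - 1) / real p) ^ j * L))"
proof (induction j)
  case 0
  then show ?case using root_approx_start[OF assms(1)] by simp
next
  case (Suc j)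
  define M where "M = ((real p - 1) / real p) ^ j * L"
  have M: "M \<ge> 0" using assms by (auto simp: M_def)
  have "root_approx p (Suc j) (exp (- L)) (exp ((real p - 1) / real p * M))"
  proof (rule root_approx_step[where \<mu> = "exp (- M / real p)" and \<rho> = "exp M"])
    show "root_approx p j (exp (- L)) (exp M)" using Suc.IH by (simp add: M_def)
    show "newton_map p (s ^ p) (exp (- M / real p) * y)
        \<le> exp ((real p - 1) / real p * M) * max s (exp (- L))"
      if "0 \<le> s" "0 < y" "s \<le> y" "y \<le> exp M * max s (exp (- L))" for s y
      using that assms(1) M by (intro newton_map_scaled_le) auto
  qed (use assms in auto)
  then show ?case by (simp add: M_def mult.assoc)
qed

lemma root_approx_quadratic_iterates:
  assumes "p \<ge> 2" "0 \<le> w" "root_approx p i a (1 + w / (real p - 1))"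
  shows "root_approx p (i + j) a (1 + w ^ 2 ^ j / (real p - 1))"
proof (induction j)
  case 0
  then show ?case using assms by simp
next
  case (Suc j)
  have "root_approx p (Suc (i + j)) a (1 + (w ^ 2 ^ j)\<^sup>2 / (real p - 1))"
  proof (rule root_approx_step[OF _ _ Suc.IH, where \<mu> = 1])
    fix s y :: real
    assume "0 \<le> s" "0 < y" "s \<le> y" "y \<le> (1 + w ^ 2 ^ j / (real p - 1)) * max s a"
    then show "newton_map p (s ^ p) (1 * y) \<le> (1 + (w ^ 2 ^ j)\<^sup>2 / (real p - 1)) * max s a"
      unfolding mult_1 using assms by (intro newton_map_quadratic) auto
  qed (use assms in auto)
  then show ?case by (simp flip: power_mult add: mult.commute)
qed

text \<open>
  The constant \<open>\<kappa>\<close> is the value of \<open>ln \<rho>\<close> at which quadratic convergence takes over, namely with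
  \<open>w = 1/2\<close>.
\<close>

lemma root_approx_two_phases:
  assumes "p \<ge> 2"
  defines "\<kappa> \<equiv> ln (1 + 1 / (2 * (real p - 1)))"
  shows "root_approx p (i + j) (exp (- (\<kappa> * (real p / (real p - 1)) ^ i)))
           (1 + (1 / 2) ^ 2 ^ j / (real p - 1))"
proof (rule root_approx_quadratic_iterates)
  have pos: "1 / (2 * (real p - 1)) > 0" using assms by auto
  then have \<kappa>: "\<kappa> \<ge> 0" unfolding \<kappa>_def by (intro ln_ge_zero) auto
  let ?L = "\<kappa> * (real p / (real p - 1)) ^ i"
  have "((real p - 1) / real p) ^ i * ?L = \<kappa>"
    using assms(1) by (simp add: power_divide)
  moreover have "root_approx p i (exp (- ?L)) (exp (((real p - 1) / real p) ^ i * ?L))"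
    using assms(1) \<kappa> by (intro root_approx_scaled_iterates) auto
  ultimately have "root_approx p i (exp (- ?L)) (exp \<kappa>)" by (simp only:)
  moreover have "exp \<kappa> = 1 + 1 / 2 / (real p - 1)"
    unfolding \<kappa>_def using pos by (subst exp_ln) (auto simp: field_simps)
  ultimately show "root_approx p i (exp (- ?L)) (1 + 1 / 2 / (real p - 1))"
    by (simp only:)
qed (use assms in auto)

text \<open>
  The absolute error is at most \<open>w/(p-1)\<close> times \<open>max(s, a) \<le> 1\<close>, plus the truncation error
  \<open>max(s, a) - s \<le> a\<close>.
\<close>

lemma root_approx_error:
  assumes "p \<ge> 2" "p ^ j \<le> n" "0 \<le> a" "a \<le> 1" "0 \<le> w" "root_approx p j a (1 + w / (real p - 1))"
  shows "\<exists>r. composite (Suc j) p (p - 1) r \<and> rat_type n (n - 1) r \<and>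
    (\<forall>x\<in>{0..1}. \<exists>v. rat_value r x v \<and> \<bar>v - root p x\<bar> \<le> w + a)"
proof -
  obtain A B where comp: "composite (Suc j) p (p - 1) (Fract A B)"
    and deg: "degree A \<le> p ^ j" "degree B \<le> p ^ j - 1"
    and val: "\<And>s. s \<in> {0..1} \<Longrightarrow> poly A (s ^ p) > 0 \<and> poly B (s ^ p) > 0 \<and>
        s \<le> poly A (s ^ p) / poly B (s ^ p) \<and>
        poly A (s ^ p) / poly B (s ^ p) \<le> (1 + w / (real p - 1)) * max s a"
    using assms(6) unfolding root_approx_def by blast
  have "B \<noteq> 0" using val[of 0] by auto
  then have "rat_type n (n - 1) (Fract A B)"
    unfolding rat_type_def using deg assms(2) by (intro exI[of _ A] exI[of _ B]) auto
  moreover have "\<exists>v. rat_value (Fract A B) x v \<and> \<bar>v - root p x\<bar> \<le> w + a"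
    if x: "x \<in> {0..1}" for x
  proof -
    define s where "s = root p x"
    have s: "s \<in> {0..1}" "s ^ p = x" using assms(1) x by (auto simp: s_def)
    define v where "v = poly A x / poly B x"
    have v: "s \<le> v" "v \<le> (1 + w / (real p - 1)) * max s a" "poly B x > 0"
      using val[OF s(1)] s(2) by (auto simp: v_def)
    have "w / (real p - 1) \<le> w / 1" using assms by (intro divide_left_mono) auto
    then have "w / (real p - 1) * max s a \<le> w * 1"
      using assms s by (intro mult_mono) auto
    moreover have "max s a \<le> s + a" using s assms by auto
    moreover have "v \<le> max s a + w / (real p - 1) * max s a"
      using v(2) by (simp only: distrib_right mult_1)
    ultimately have "v \<le> s + (w + a)" by linarith
    moreover have "rat_value (Fract A B) x v"
      unfolding rat_value_def v_def using v(3) less_imp_neq[of 0 "poly B x"] by metis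
    ultimately show ?thesis using v(1) unfolding s_def by (intro exI[of _ v]) auto
  qed
  ultimately show ?thesis using comp by blast
qed

section \<open>Balancing the two phases\<close>

text \<open>
  For \<open>\<theta> = ln 2 / ln (2 q)\<close> one has \<open>q powr \<theta> = 2 powr (1 - \<theta>) = B\<close>.  Rounding \<open>\<theta> K\<close> up to the
  integer \<open>i\<close> only helps \<open>q^i\<close> and costs at most a factor 2 in \<open>2^(K-i)\<close>.
\<close>

lemma balanced_split:
  fixes q :: real
  assumes "q > 1"
  defines "B \<equiv> exp (ln q * ln 2 / ln (2 * q))"
  obtains i j where "i + j = K" "B ^ K \<le> q ^ i" "B ^ K \<le> 2 * 2 ^ j"
proof -
  define \<theta> where "\<theta> = ln 2 / ln (2 * q)"
  have lq: "ln q > 0" using assms by auto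
  have l2q: "ln (2 * q) = ln 2 + ln q" using assms by (simp add: ln_mult)
  have \<theta>: "0 < \<theta>" "\<theta> < 1"
    using lq add_pos_pos[of "ln 2" "ln q"] unfolding \<theta>_def l2q by auto
  have B: "B = exp (\<theta> * ln q)" by (simp add: B_def \<theta>_def)
  have "\<theta> * (ln 2 + ln q) = ln 2"
    using lq add_pos_pos[of "ln 2" "ln q"] unfolding \<theta>_def l2q by simp
  then have "\<theta> * ln q = (1 - \<theta>) * ln 2" by (simp add: algebra_simps)
  then have B2: "B = exp ((1 - \<theta>) * ln 2)" unfolding B by (simp only:)
  define i where "i = nat \<lceil>\<theta> * real K\<rceil>"
  have "\<theta> * real K \<le> 1 * real K" using \<theta> by (intro mult_right_mono) auto
  then have iK: "i \<le> K" unfolding i_def by linarith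
  have i: "\<theta> * real K \<le> real i" "real i \<le> \<theta> * real K + 1"
    unfolding i_def using \<theta> by (auto simp: of_nat_nat)
  show ?thesis
  proof (rule that[of i "K - i"])
    show "i + (K - i) = K" using iK by simp
    have "B ^ K = exp (\<theta> * real K * ln q)" unfolding B
      by (simp flip: exp_of_nat_mult add: algebra_simps)
    also have "\<dots> \<le> exp (real i * ln q)" using i lq by auto
    also have "\<dots> = q ^ i" using assms by (simp add: exp_of_nat_mult)
    finally show "B ^ K \<le> q ^ i" .
    have "(1 - \<theta>) * real K \<le> real (Suc (K - i))"
      using i iK by (simp add: of_nat_diff algebra_simps)
    then have "exp ((1 - \<theta>) * real K * ln 2) \<le> exp (real (Suc (K - i)) * ln 2)"
      by (simp only: exp_le_cancel_iff mult_right_mono ln_ge_zero one_le_numeral)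
    moreover have "B ^ K = exp ((1 - \<theta>) * real K * ln 2)" unfolding B2
      by (simp flip: exp_of_nat_mult add: algebra_simps)
    ultimately have "B ^ K \<le> exp (real (Suc (K - i)) * ln 2)" by simp
    also have "\<dots> = 2 ^ Suc (K - i)" by (simp only: exp_of_nat_mult) simp
    finally show "B ^ K \<le> 2 * 2 ^ (K - i)" by simp
  qed
qed

theorem theorem1p1:
  fixes p :: nat and c :: real
  assumes "p \<ge> 2"
    and "c = (ln (real p / (real p - 1)) * ln 2) / (ln (2 * real p / (real p - 1)) * ln (real p))"
  shows "\<exists>N::nat. \<exists>b::real. N > 0 \<and> b > 0 \<and>
    (\<forall>n\<ge>N. \<exists>r. composite (nat \<lfloor>log (real p) (real n)\<rfloor> + 1) p (p - 1) r \<and>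
       rat_type n (n - 1) r \<and>
       (\<forall>x\<in>{0..1}. \<exists>v. rat_value r x v \<and> \<bar>v - root p x\<bar> \<le> exp (- b * real n powr c)))"
proof -
  define q where "q = real p / (real p - 1)"
  define B where "B = exp (ln q * ln 2 / ln (2 * q))"
  define \<kappa> where "\<kappa> = ln (1 + 1 / (2 * (real p - 1)))"
  \<comment> \<open>Both error terms will be at most \<open>exp (- \<beta> * B ^ K)\<close>; the 2 makes up for rounding in the split.\<close>
  define \<beta> where "\<beta> = min \<kappa> (ln 2 / 2)"
  \<comment> \<open>The factor \<open>B\<close> is lost because \<open>n\<close> may be close to \<open>p ^ (K + 1)\<close>, the 2 when adding the errors.\<close>
  define b where "b = \<beta> / (2 * B)"
  have q: "q > 1" using assms by (auto simp: q_def)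
  have lp: "ln (real p) > 0" using assms by auto
  have B: "B > 1" unfolding B_def using q by auto
  have \<kappa>: "\<kappa> > 0" unfolding \<kappa>_def using assms(1) by (intro ln_gt_zero) auto
  have \<beta>: "\<beta> > 0" using \<kappa> by (auto simp: \<beta>_def)
  have b: "b > 0" using \<beta> B by (auto simp: b_def)
  have "c = ln q * ln 2 / ln (2 * q) / ln (real p)"
    unfolding assms(2) q_def by simp
  then have pc: "real p powr c = B"
    unfolding powr_def B_def using assms(1) lp by (simp add: mult.commute)
  have c: "c > 0" unfolding \<open>c = ln q * _ / _ / _\<close> using q lp by auto
  \<comment> \<open>From \<open>n = p ^ K0\<close> on, half of the exponent \<open>\<beta> * B ^ K\<close> absorbs the factor 2 that
      adding the two error terms costs.\<close>
  obtain K0 where K0: "2 * ln 2 / \<beta> < B ^ K0" using real_arch_pow[OF B] by blast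
  have main: "\<exists>r. composite (nat \<lfloor>log (real p) (real n)\<rfloor> + 1) p (p - 1) r \<and>
       rat_type n (n - 1) r \<and>
       (\<forall>x\<in>{0..1}. \<exists>v. rat_value r x v \<and> \<bar>v - root p x\<bar> \<le> exp (- b * real n powr c))"
    if n: "n \<ge> p ^ K0" for n
  proof -
    define K where "K = nat \<lfloor>log (real p) (real n)\<rfloor>"
    have n0: "n > 0" using n assms(1) by (metis gr0I le_zero_eq not_numeral_le_zero power_eq_0_iff)
    have lge: "real K0 \<le> log (real p) (real n)"
      using n n0 assms(1) by (subst le_log_iff) (auto simp: powr_realpow simp flip: of_nat_power)
    have K: "real K \<le> log (real p) (real n)" "log (real p) (real n) < real (Suc K)" "K0 \<le> K"
      unfolding K_def using lge by linarith+
    have pKn: "p ^ K \<le> n"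
      using K(1) n0 assms(1) by (subst (asm) le_log_iff) (auto simp: powr_realpow simp flip: of_nat_power)
    have "real n \<le> real p powr real (Suc K)"
      using K(2) n0 assms(1) by (subst (asm) log_less_iff) auto
    then have "real n powr c \<le> (real p powr real (Suc K)) powr c"
      using c by (intro powr_mono2) auto
    also have "\<dots> = B powr real (Suc K)" by (simp only: powr_powr mult.commute flip: pc)
    also have "\<dots> = B * B ^ K" using B by (simp only: powr_realpow) simp
    finally have nc: "b * real n powr c \<le> b * (B * B ^ K)" using b by simp
    also have "b * (B * B ^ K) = \<beta> * B ^ K / 2" using B by (simp add: b_def)
    finally have nc: "b * real n powr c \<le> \<beta> * B ^ K / 2" .
    obtain i j where ij: "i + j = K" "B ^ K \<le> q ^ i" "B ^ K \<le> 2 * 2 ^ j"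
      using balanced_split[OF q, of K] unfolding B_def by metis
    define a where "a = exp (- (\<kappa> * q ^ i))"
    define w :: real where "w = (1 / 2) ^ 2 ^ j"
    have "root_approx p K a (1 + w / (real p - 1))"
      using root_approx_two_phases[OF assms(1), of i j] ij(1)
      by (simp add: a_def w_def q_def \<kappa>_def)
    then obtain r where r: "composite (Suc K) p (p - 1) r" "rat_type n (n - 1) r"
      "\<And>x. x \<in> {0..1} \<Longrightarrow> \<exists>v. rat_value r x v \<and> \<bar>v - root p x\<bar> \<le> w + a"
      using root_approx_error[OF assms(1) pKn, of a w] \<kappa> q by (auto simp: a_def w_def)
    have "\<beta> * B ^ K \<le> \<kappa> * q ^ i"
      using ij(2) \<kappa> \<beta> B by (intro mult_mono) (auto simp: \<beta>_def)
    then have a: "a \<le> exp (- (\<beta> * B ^ K))" by (simp add: a_def)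
    have "\<beta> * B ^ K \<le> ln 2 / 2 * (2 * 2 ^ j)"
      using ij(3) \<beta> B by (intro mult_mono) (auto simp: \<beta>_def)
    moreover have "w = exp (real (2 ^ j) * (- ln 2))"
      unfolding w_def exp_of_nat_mult by (simp add: exp_minus field_simps)
    ultimately have w: "w \<le> exp (- (\<beta> * B ^ K))" by (simp add: mult.commute)
    have "2 * ln 2 / \<beta> \<le> B ^ K"
      using K0 power_increasing[OF K(3), of B] B by linarith
    then have "ln 2 \<le> \<beta> * B ^ K / 2" using \<beta> by (simp add: field_simps)
    then have "ln 2 - \<beta> * B ^ K \<le> - b * real n powr c" using nc by simp
    then have "exp (ln 2 - \<beta> * B ^ K) \<le> exp (- b * real n powr c)" by simp
    moreover have "exp (ln 2 - \<beta> * B ^ K) = 2 * exp (- (\<beta> * B ^ K))"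
      by (simp add: exp_diff exp_minus field_simps)
    ultimately have err: "w + a \<le> exp (- b * real n powr c)" using a w by linarith
    have "\<exists>v. rat_value r x v \<and> \<bar>v - root p x\<bar> \<le> exp (- b * real n powr c)"
      if "x \<in> {0..1}" for x
      using r(3)[OF that] err by (meson order_trans)
    then show ?thesis using r(1,2) unfolding K_def by auto
  qed
  have "p ^ K0 > 0" using assms(1) by simp
  then show ?thesis using main b by blast
qed

end
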